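(* For every $n\ge 3$, let $G_n^6$ be the graph on vertex set $\{c_0,a_1,\dots,a_n,b_1,\dots,b_n\}$ whose non-edges are exactly the $2n+1$ pairs of consecutive vertices on the cycle $c_0,a_1,b_1,a_2,b_2,\dots,a_n,b_n,c_0$ (i.e. $\{c_0,a_1\}$, $\{a_i,b_i\}$ for $1\le i\le n$, $\{b_i,a_{i+1}\}$ for $1\le i\le n-1$, and $\{b_n,c_0\}$), all other pairs of distinct vertices being adjacent. Then $G_n^6$ is word-representable.
   Context: All graphs are finite and simple. For a word $w$ and letters $i,j$, let $w_{ij}$ be the subsequence of $w$ consisting of all occurrences of $i$ and $j$; $i$ and $j$ alternate in $w$ if $w_{ij}$ contains no factor $ii$ or $jj$. A graph $G$ is word-representable if there is a word $w$ over $V(G)$ such that for all distinct $i,j\in V(G)$, $\{i,j\}\in E(G)$ if and only if $i$ and $j$ alternate in $w$. *)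

theory Defs
  imports Main "HOL-Library.Sublist"
begin

definition simple_graph :: "'a set \<Rightarrow> 'a set set \<Rightarrow> bool" where
  "simple_graph V E \<longleftrightarrow> finite V \<and> E \<subseteq> {{u, v} | u v. u \<in> V \<and> v \<in> V \<and> u \<noteq> v}"

definition restrict_word :: "'a list \<Rightarrow> 'a \<Rightarrow> 'a \<Rightarrow> 'a list" where
  "restrict_word w i j = filter (\<lambda>x. x = i \<or> x = j) w"

(* "sublist" is the contiguous (factor) relation, as opposed to "subseq". *)
definition alternate :: "'a list \<Rightarrow> 'a \<Rightarrow> 'a \<Rightarrow> bool" where
  "alternate w i j \<longleftrightarrow>
     \<not> sublist [i, i] (restrict_word w i j) \<and> \<not> sublist [j, j] (restrict_word w i j)"

definition represents :: "'a list \<Rightarrow> 'a set \<Rightarrow> 'a set set \<Rightarrow> bool" where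
  "represents w V E \<longleftrightarrow>
     (\<forall>i \<in> V. \<forall>j \<in> V. i \<noteq> j \<longrightarrow> ({i, j} \<in> E \<longleftrightarrow> alternate w i j))"

(* Not every letter of V is required to occur in w. Some authors do require this;
   word_representable_iff_all_letters shows that the two conventions agree. *)
definition word_representable :: "'a set \<Rightarrow> 'a set set \<Rightarrow> bool" where
  "word_representable V E \<longleftrightarrow> (\<exists>w. set w \<subseteq> V \<and> represents w V E)"

datatype vertex = C0 | A nat | B nat

definition G6_verts :: "nat \<Rightarrow> vertex set" where
  "G6_verts n = {C0} \<union> A ` {1..n} \<union> B ` {1..n}"

definition G6_nonedges :: "nat \<Rightarrow> vertex set set" where
  "G6_nonedges n =
     {{C0, A 1}} \<union> {{A i, B i} | i. 1 \<le> i \<and> i \<le> n}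
     \<union> {{B i, A (i + 1)} | i. 1 \<le> i \<and> i \<le> n - 1} \<union> {{B n, C0}}"

definition G6_edges :: "nat \<Rightarrow> vertex set set" where
  "G6_edges n =
     {{u, v} | u v. u \<in> G6_verts n \<and> v \<in> G6_verts n \<and> u \<noteq> v \<and> {u, v} \<notin> G6_nonedges n}"

lemma simple_graph_G6: "simple_graph (G6_verts n) (G6_edges n)"
  unfolding simple_graph_def G6_verts_def G6_edges_def by auto

lemma card_G6_nonedges:
  assumes "n \<ge> 3"
  shows "card (G6_nonedges n) = 2 * n + 1"
proof -
  let ?P = "(\<lambda>i. {A i, B i}) ` {1..n}" and ?Q = "(\<lambda>i. {B i, A (i + 1)}) ` {1..n - 1}"
  have eq: "G6_nonedges n = insert {C0, A 1} (insert {B n, C0} (?P \<union> ?Q))"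
    unfolding G6_nonedges_def by auto
  have P: "card ?P = n"
    by (subst card_image) (auto simp: inj_on_def doubleton_eq_iff)
  have Q: "card ?Q = n - 1"
    by (subst card_image) (auto simp: inj_on_def doubleton_eq_iff)
  have "{A i, B i} \<noteq> {B j, A (j + 1)}" for i j
    by (simp add: doubleton_eq_iff)
  then have "?P \<inter> ?Q = {}"
    by blast
  then have PQ: "card (?P \<union> ?Q) = n + (n - 1)"
    using P Q by (subst card_Un_disjoint) auto
  have "C0 \<notin> e" if "e \<in> ?P \<union> ?Q" for e
    using that by auto
  then have "{B n, C0} \<notin> ?P \<union> ?Q" "{C0, A 1} \<notin> ?P \<union> ?Q"
    by blast+
  moreover have "{C0, A 1} \<noteq> {B n, C0}"
    by (simp add: doubleton_eq_iff)
  ultimately show ?thesis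
    using assms PQ unfolding eq by simp
qed

lemma restrict_word_absent:
  assumes "i \<notin> set w"
  shows "restrict_word w i j = replicate (count_list w j) j"
  using assms unfolding restrict_word_def by (induction w) auto

lemma alternate_commute: "alternate w i j \<longleftrightarrow> alternate w j i"
proof -
  have "restrict_word w i j = restrict_word w j i"
    unfolding restrict_word_def by (rule filter_cong) auto
  then show ?thesis unfolding alternate_def by auto
qed

lemma sublist_doubleton_replicate:
  "sublist [x, x] (replicate k y) \<longleftrightarrow> x = y \<and> 2 \<le> k"
proof
  assume *: "sublist [x, x] (replicate k y)"
  then have "set [x, x] \<subseteq> set (replicate k y)"
    by (rule set_mono_sublist)
  then show "x = y \<and> 2 \<le> k"
    using sublist_length_le[OF *] by auto
next
  assume *: "x = y \<and> 2 \<le> k"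
  then obtain m where "k = Suc (Suc m)"
    by (metis add_2_eq_Suc le_Suc_ex)
  then show "sublist [x, x] (replicate k y)"
    using * by (auto simp: sublist_def intro: exI[of _ "[]"])
qed

lemma alternate_Cons_absent:
  assumes "m \<notin> set w" "i \<noteq> j"
  shows "alternate (m # w) i j \<longleftrightarrow> alternate w i j"
proof -
  have first: "alternate (m # w) m k \<longleftrightarrow> alternate w m k" if "m \<noteq> k" for k
  proof -
    define c where "c = count_list w k"
    have w: "restrict_word w m k = replicate c k"
      unfolding c_def by (rule restrict_word_absent[OF assms(1)])
    then have mw: "restrict_word (m # w) m k = m # replicate c k"
      by (simp add: restrict_word_def)
    show ?thesis
      unfolding alternate_def w mw using that
      by (cases c) (simp_all add: sublist_Cons_right sublist_doubleton_replicate)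
  qed
  consider "i = m" | "j = m" | "i \<noteq> m" "j \<noteq> m" by blast
  then show ?thesis
  proof cases
    case 1 then show ?thesis using first[of j] assms by simp
  next
    case 2 then show ?thesis
      using first[of i] assms alternate_commute[of _ i j] by simp
  next
    case 3 then show ?thesis by (auto simp: alternate_def restrict_word_def)
  qed
qed

lemma word_representable_iff_all_letters:
  assumes "finite V"
  shows "word_representable V E \<longleftrightarrow> (\<exists>w. set w = V \<and> represents w V E)"
proof
  assume "word_representable V E"
  then obtain w where w: "set w \<subseteq> V" "represents w V E"
    unfolding word_representable_def by blast
  obtain ms where ms: "set ms = V - set w" "distinct ms"
    using finite_distinct_list[of "V - set w"] assms by auto
  have "alternate (xs @ w) i j \<longleftrightarrow> alternate w i j"
    if "distinct xs" "set xs \<inter> set w = {}" "i \<noteq> j" for xs i j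
    using that by (induction xs) (auto simp: alternate_Cons_absent)
  moreover have "set ms \<inter> set w = {}"
    using ms by auto
  ultimately have "represents (ms @ w) V E"
    using w(2) ms unfolding represents_def by simp
  moreover have "set (ms @ w) = V" using ms w by auto
  ultimately show "\<exists>w. set w = V \<and> represents w V E" by blast
qed (auto simp: word_representable_def)

end

theory Submission
  imports Defs
begin

text \<open>In the periodic word $(v_0 v_1 \cdots v_N)^k$ all letters alternate, and exchanging two
  neighbouring letters of a word affects the alternation of that pair only. Hence exchanging one
  occurrence of each pair of cyclically consecutive letters destroys exactly the alternations along
  the cycle $v_0 v_1 \cdots v_N$, so the complement of a cycle is word-representable.\<close>

lemma restrict_word_append:
  "restrict_word (u @ v) i j = restrict_word u i j @ restrict_word v i j"
  by (simp add: restrict_word_def)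

lemma restrict_word_concat:
  "restrict_word (concat ws) i j = concat (map (\<lambda>w. restrict_word w i j) ws)"
  by (simp add: restrict_word_def filter_concat)

text \<open>If \<open>x = y\<close> both sides coincide. Otherwise the filter keeps at most one of
  \<open>x\<close> and \<open>y\<close>, so their order leaves no trace.\<close>

lemma restrict_word_exchange:
  assumes "{i, j} \<noteq> {x, y}"
  shows "restrict_word (u @ [x, y] @ v) i j = restrict_word (u @ [y, x] @ v) i j"
  using assms by (auto simp: restrict_word_def)

lemma restrict_word_upt:
  assumes "a < b" "b < m"
  shows "restrict_word [0..<m] a b = [a, b]"
proof -
  have "[0..<m] = [0..<a] @ [a] @ [Suc a..<b] @ [b] @ [Suc b..<m]"
    using assms upt_add_eq_append[of 0 a "m - a"] upt_add_eq_append[of "Suc a" b "m - b"]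
    by (simp add: upt_conv_Cons)
  moreover have "filter (\<lambda>x. x = a \<or> x = b) [l..<k] = []"
    if "\<And>x. l \<le> x \<Longrightarrow> x < k \<Longrightarrow> x \<noteq> a \<and> x \<noteq> b" for l k
    using that by (auto simp: filter_empty_conv)
  ultimately show ?thesis
    using assms by (simp add: restrict_word_def)
qed

lemma alternate_concat_replicate:
  assumes "i \<noteq> j" "restrict_word w i j = concat (replicate k [i, j])"
  shows "alternate w i j"
proof -
  have "\<not> sublist [i, i] (concat (replicate k [i, j]))"
    using assms(1) by (induction k) (auto simp: sublist_Cons_right)
  moreover have "\<not> sublist [j, j] (concat (replicate k [i, j]))"
  proof (induction k)
    case (Suc k)
    then show ?case
      \<comment> \<open>A factor \<open>[j, j]\<close> could only arise where two blocks meet; the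
        case split on \<open>k\<close> exposes the \<open>i\<close> that opens the next block, if
        there is one.\<close>
      using assms(1) by (cases k) (auto simp: sublist_Cons_right)
  qed simp
  ultimately show ?thesis
    using assms(2) by (simp add: alternate_def)
qed

lemma not_alternateI:
  assumes "restrict_word w i j = us @ [i, i] @ vs"
  shows "\<not> alternate w i j"
  using assms by (auto simp: alternate_def sublist_def)

lemma sublist_map_inj_iff:
  assumes "inj f"
  shows "sublist (map f xs) (map f ys) \<longleftrightarrow> sublist xs ys"
proof
  assume "sublist (map f xs) (map f ys)"
  then have "sublist (map (inv f) (map f xs)) (map (inv f) (map f ys))"
    by (rule map_mono_sublist)
  then show "sublist xs ys"
    using assms by simp
qed (rule map_mono_sublist)

text \<open>Allows the word to be built over the positions 0 to N and renamed to vertices at the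
  end.\<close>

lemma alternate_map:
  assumes "inj f"
  shows "alternate (map f w) (f i) (f j) \<longleftrightarrow> alternate w i j"
proof -
  have "restrict_word (map f w) (f i) (f j) = map f (restrict_word w i j)"
    using assms by (simp add: restrict_word_def filter_map comp_def inj_eq)
  then show ?thesis
    using sublist_map_inj_iff[OF assms, of "[_, _]"] by (simp add: alternate_def)
qed

text \<open>For \<open>i < N\<close>, one period 0 1 ... N with the neighbours \<open>i\<close> and
  \<open>Suc i\<close> exchanged. Each such pair gets a period of its own, so the exchanges do not
  interfere.\<close>

definition exchange_block :: "nat \<Rightarrow> nat \<Rightarrow> nat list" where
  "exchange_block N i = [0..<i] @ [Suc i, i] @ [Suc (Suc i)..<Suc N]"

text \<open>The part after the blocks is two periods with the inner pair $N 0$ exchanged.\<close>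

definition cocycle_word :: "nat \<Rightarrow> nat list" where
  "cocycle_word N =
     concat (map (exchange_block N) [0..<N]) @ [0..<N] @ [0, N] @ [1..<Suc N]"

lemma set_cocycle_word: "set (cocycle_word N) \<subseteq> {..N}"
  by (auto simp: cocycle_word_def exchange_block_def)

lemma upt_split_pair:
  assumes "i < N"
  shows "[0..<i] @ [i, Suc i] @ [Suc (Suc i)..<Suc N] = [0..<Suc N]"
  using assms upt_add_eq_append[of 0 i "Suc N - i"] by (simp add: upt_conv_Cons del: upt_Suc)

lemma restrict_exchange_block:
  assumes "i < N" "a < b" "b \<le> N"
  shows "restrict_word (exchange_block N i) a b = (if a = i \<and> b = Suc i then [b, a] else [a, b])"
proof (cases "a = i \<and> b = Suc i")
  case True
  then show ?thesis
    by (auto simp: exchange_block_def restrict_word_def filter_empty_conv simp del: upt_Suc)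
next
  case False
  then have "{a, b} \<noteq> {Suc i, i}"
    using assms by (auto simp: doubleton_eq_iff)
  then show ?thesis
    using False assms restrict_word_upt[of a b "Suc N"]
    by (metis exchange_block_def restrict_word_exchange upt_split_pair le_imp_less_Suc)
qed

text \<open>The closing pair N, 0 meets at the boundary between two periods, so exchanging it takes
  two periods instead of one block. Every other pair sees the two periods unchanged.\<close>

lemma restrict_last_periods:
  assumes "a < b" "b \<le> N"
  shows "restrict_word ([0..<N] @ [0, N] @ [1..<Suc N]) a b =
    (if a = 0 \<and> b = N then [a, a, b, b] else [a, b, a, b])"
proof (cases "a = 0 \<and> b = N")
  case True
  then have *: "[0..<N] = 0 # [1..<N]" "[1..<Suc N] = [1..<N] @ [N]"
    using assms by (simp_all add: upt_conv_Cons)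
  show ?thesis
    unfolding * using True by (auto simp: restrict_word_def filter_empty_conv)
next
  case False
  then have "{a, b} \<noteq> {0, N}"
    using assms by (auto simp: doubleton_eq_iff)
  then have "restrict_word ([0..<N] @ [0, N] @ [1..<Suc N]) a b
      = restrict_word ([0..<N] @ [N, 0] @ [1..<Suc N]) a b"
    by (rule restrict_word_exchange)
  also have "[0..<N] @ [N, 0] @ [1..<Suc N] = [0..<Suc N] @ [0..<Suc N]"
    by (subst upt_conv_Cons[of 0 "Suc N"]) simp_all
  finally show ?thesis
    using False assms by (simp add: restrict_word_append restrict_word_upt del: upt_Suc)
qed

text \<open>A pair of cyclic neighbours is exchanged once, which doubles a letter in its
  restriction; any other pair restricts to a power of \<open>[a, b]\<close>.\<close>

lemma alternate_cocycle_word: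
  assumes "a < b" "b \<le> N" "2 \<le> N"
  shows "alternate (cocycle_word N) a b \<longleftrightarrow> b \<noteq> Suc a \<and> \<not> (a = 0 \<and> b = N)"
proof -
  let ?block = "\<lambda>i. if a = i \<and> b = Suc i then [b, a] else [a, b]"
  let ?last = "if a = 0 \<and> b = N then [a, a, b, b] else [a, b, a, b]"
  have *: "map (\<lambda>i. restrict_word (exchange_block N i) a b) [0..<N] = map ?block [0..<N]"
    using assms by (intro map_cong) (auto simp: restrict_exchange_block)
  have w: "restrict_word (cocycle_word N) a b = concat (map ?block [0..<N]) @ ?last"
    unfolding cocycle_word_def restrict_word_append[of "concat _"] restrict_word_concat
      restrict_last_periods[OF assms(1,2)]
    using * by (simp only: map_map comp_def)
  consider "a = 0" "b = N" | "b = Suc a" "\<not> (a = 0 \<and> b = N)"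
    | "b \<noteq> Suc a" "\<not> (a = 0 \<and> b = N)" by blast
  then show ?thesis
  proof cases
    case 1
    then show ?thesis
      using not_alternateI[of _ a b _ "[b, b]"] w by simp
  next
    case 2
    then have split: "[0..<N] = [0..<a] @ a # [Suc a..<N]"
      using assms upt_add_eq_append[of 0 a "N - a"] by (simp add: upt_conv_Cons)
    have "map ?block [Suc a..<N] = replicate (N - Suc a) [a, b]"
      by (intro nth_equalityI) auto
    \<comment> \<open>The exchanged block ends in \<open>a\<close>, and an \<open>a\<close> must
      follow to give the factor \<open>[a, a]\<close>. It comes from the next block or, when
      \<open>a = N - 1\<close>, from the last two periods.\<close>
    then obtain vs where vs: "concat (map ?block [Suc a..<N]) @ [a, b, a, b] = a # vs"
      by (cases "N - Suc a") auto
    have "restrict_word (cocycle_word N) a b = (concat (map ?block [0..<a]) @ [b]) @ [a, a] @ vs"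
      unfolding w split if_not_P[OF 2(2)] map_append concat_append append_assoc list.map
        concat.simps vs
      using 2(1) by simp
    from not_alternateI[OF this] show ?thesis
      using 2 by simp
  next
    case 3
    then have "map ?block [0..<N] = replicate N [a, b]"
      by (intro nth_equalityI) auto
    \<comment> \<open>There are N blocks and two final periods, each contributing one
      \<open>[a, b]\<close>.\<close>
    then have "restrict_word (cocycle_word N) a b = concat (replicate (N + 2) [a, b])"
      using w 3 by (simp only: replicate_add concat_append) (simp add: numeral_2_eq_2)
    then show ?thesis
      using 3 assms alternate_concat_replicate by (metis less_irrefl)
  qed
qed

text \<open>Position on the cycle of non-edges, starting at \<open>C0\<close>. \<open>A 0\<close>
  and \<open>B 0\<close> also receive 0, but they are not vertices of the graph.\<close>

fun cycle_index :: "vertex \<Rightarrow> nat" where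
  "cycle_index C0 = 0"
| "cycle_index (A i) = 2 * i - 1"
| "cycle_index (B i) = 2 * i"

text \<open>Inverse to \<open>cycle_index\<close> on the vertices. It is given on all naturals so as
  to be injective outright, as \<open>alternate_map\<close> requires.\<close>

definition cycle_vertex :: "nat \<Rightarrow> vertex" where
  "cycle_vertex k = (if k = 0 then C0 else if odd k then A (Suc k div 2) else B (k div 2))"

lemma cycle_vertex_in_verts: "k \<le> 2 * n \<Longrightarrow> cycle_vertex k \<in> G6_verts n"
  by (auto simp: cycle_vertex_def G6_verts_def image_iff elim!: oddE evenE)

lemma inj_cycle_vertex: "inj cycle_vertex"
proof (rule inj_on_inverseI)
  show "cycle_index (cycle_vertex k) = k" for k
    by (auto simp: cycle_vertex_def elim!: oddE)
qed

lemma cycle_vertex_index: "x \<in> G6_verts n \<Longrightarrow> cycle_vertex (cycle_index x) = x"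
  by (auto simp: cycle_vertex_def G6_verts_def)

lemma cycle_index_le: "x \<in> G6_verts n \<Longrightarrow> cycle_index x \<le> 2 * n"
  by (auto simp: G6_verts_def)

lemma G6_edges_iff_cycle_index:
  assumes "x \<in> G6_verts n" "y \<in> G6_verts n" "cycle_index x < cycle_index y"
  shows "{x, y} \<in> G6_edges n \<longleftrightarrow> cycle_index y \<noteq> Suc (cycle_index x)
    \<and> \<not> (cycle_index x = 0 \<and> cycle_index y = 2 * n)"
proof -
  have "{x, y} \<in> G6_edges n \<longleftrightarrow> {x, y} \<notin> G6_nonedges n"
    using assms by (auto simp: G6_edges_def)
  also have "{x, y} \<in> G6_nonedges n \<longleftrightarrow> cycle_index y = Suc (cycle_index x)
    \<or> (cycle_index x = 0 \<and> cycle_index y = 2 * n)"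
    using assms
    \<comment> \<open>Consecutive positions are 0, 1 for \<open>C0\<close>, \<open>A 1\<close>, then
      2i-1, 2i for \<open>A i\<close>, \<open>B i\<close>, and 2i, 2i+1 for \<open>B i\<close>,
      \<open>A (i + 1)\<close>; parity excludes the remaining combinations.\<close>
    by (cases x; cases y) (auto simp: G6_nonedges_def G6_verts_def doubleton_eq_iff; presburger)+
  finally show ?thesis by blast
qed

theorem theorem6:
  fixes n :: nat
  assumes "n \<ge> 3"
  shows "word_representable (G6_verts n) (G6_edges n)"
proof -
  \<comment> \<open>The cycle has 2n+1 vertices, so its positions run from 0 to N = 2n.\<close>
  define w where "w = map cycle_vertex (cocycle_word (2 * n))"
  have less: "{x, y} \<in> G6_edges n \<longleftrightarrow> alternate w x y"
    if "x \<in> G6_verts n" "y \<in> G6_verts n" "cycle_index x < cycle_index y" for x y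
  proof -
    have "alternate w x y \<longleftrightarrow> alternate (cocycle_word (2 * n)) (cycle_index x) (cycle_index y)"
      using alternate_map[OF inj_cycle_vertex, of _ "cycle_index x" "cycle_index y"] that
      by (simp add: w_def cycle_vertex_index)
    then show ?thesis
      using that assms
      by (simp add: alternate_cocycle_word G6_edges_iff_cycle_index cycle_index_le)
  qed
  have "{x, y} \<in> G6_edges n \<longleftrightarrow> alternate w x y"
    if "x \<in> G6_verts n" "y \<in> G6_verts n" "x \<noteq> y" for x y
  proof -
    have "cycle_index x \<noteq> cycle_index y"
      using that cycle_vertex_index by metis
    then show ?thesis
      \<comment> \<open>Edges and alternation are both symmetric, so the vertex with the smaller
        position may be taken first.\<close>
      using less[of x y] less[of y x] that by (metis alternate_commute insert_commute
        linorder_neqE_nat)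
  qed
  moreover have "set w \<subseteq> G6_verts n"
    using set_cocycle_word cycle_vertex_in_verts by (fastforce simp: w_def)
  ultimately show ?thesis
    unfolding word_representable_def represents_def by blast
qed

end
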